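(* Let $X$ be an order-zero-dimensional space and let $(Y,e)$ be a Priestley order-compactification of $X$. Put $\mathcal{R}_Y=\{e^{-1}(U): U\in\mathsf{ClopUp}(Y)\}$ and $\mathcal{B}_Y=\{e^{-1}(W): W \text{ a clopen subset of } Y\}$. Then the following are equivalent: (a) $(Y,e)$ is an N-order-compactification of $X$, i.e. the order $\le_Y$ on $Y$ equals the closure in $Y\times Y$ of $(e\times e)[\le_X]=\{(e(x),e(x')) : x\le_X x'\}$; (b) $\mathcal{R}_Y$ is an N-basis, i.e. for all $W,V\in\mathcal{B}_Y$, if ${\uparrow}W\cap{\downarrow}V=\varnothing$ (upset and downset taken in $X$), then there is $K\in\mathcal{R}_Y$ with $W\subseteq K$ and $V\subseteq X\setminus K$.
   Context: An ordered space is a set equipped with a partial order $\le$ and a topology (no compatibility assumed). For $S\subseteq X$, ${\uparrow}S=\{x:\exists s\in S,\ s\le x\}$ and ${\downarrow}S=\{x:\exists s\in S,\ x\le s\}$; $S$ is an upset if $S={\uparrow}S$. $\mathsf{ClopUp}(X)$ denotes the set of clopen upsets of $X$. $X$ satisfies the Priestley separation axiom if whenever $x\not\le y$ there is a clopen upset $U$ with $x\in U$, $y\notin U$. $X$ is order-zero-dimensional if it satisfies Priestley separation and $\{U\setminus V: U,V\in\mathsf{ClopUp}(X)\}$ is a basis for its topology. A Priestley space is a compact ordered space satisfying Priestley separation. A Nachbin space is a compact ordered space whose order is closed in $X\times X$. An order-embedding $e:X\to Y$ is a topological embedding such that $x\le y$ iff $e(x)\le e(y)$. An order-compactification of $X$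 is a pair $(Y,e)$ with $Y$ a Nachbin space and $e:X\to Y$ an order-embedding with $e[X]$ dense in $Y$; it is a Priestley order-compactification if $Y$ is a Priestley space. *)

theory Defs
  imports "HOL-Analysis.Analysis"
begin

text \<open>An ordered space is given by a topology \<open>X\<close> and an order relation \<open>r\<close> on its
  underlying set \<open>topspace X\<close>; \<open>(x, y) \<in> r\<close> means \<open>x \<le> y\<close>.\<close>

definition ordered_space :: "'a topology \<Rightarrow> 'a rel \<Rightarrow> bool" where
  "ordered_space X r \<longleftrightarrow> partial_order_on (topspace X) r"

definition up_set :: "'a topology \<Rightarrow> 'a rel \<Rightarrow> 'a set \<Rightarrow> 'a set" where
  "up_set X r S = {x \<in> topspace X. \<exists>s\<in>S. (s, x) \<in> r}"

definition down_set :: "'a topology \<Rightarrow> 'a rel \<Rightarrow> 'a set \<Rightarrow> 'a set" where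
  "down_set X r S = {x \<in> topspace X. \<exists>s\<in>S. (x, s) \<in> r}"

definition is_upset :: "'a topology \<Rightarrow> 'a rel \<Rightarrow> 'a set \<Rightarrow> bool" where
  "is_upset X r S \<longleftrightarrow> S = up_set X r S"

definition clopenin :: "'a topology \<Rightarrow> 'a set \<Rightarrow> bool" where
  "clopenin X S \<longleftrightarrow> closedin X S \<and> openin X S"

definition ClopUp :: "'a topology \<Rightarrow> 'a rel \<Rightarrow> 'a set set" where
  "ClopUp X r = {U. clopenin X U \<and> is_upset X r U}"

definition priestley_separation :: "'a topology \<Rightarrow> 'a rel \<Rightarrow> bool" where
  "priestley_separation X r \<longleftrightarrow>
     (\<forall>x\<in>topspace X. \<forall>y\<in>topspace X. (x, y) \<notin> r \<longrightarrow> (\<exists>U\<in>ClopUp X r. x \<in> U \<and> y \<notin> U))"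

text \<open>The second conjunct below says that the differences of clopen upsets form a basis:
  the open sets are exactly the arbitrary unions of such differences.\<close>

definition order_zero_dimensional :: "'a topology \<Rightarrow> 'a rel \<Rightarrow> bool" where
  "order_zero_dimensional X r \<longleftrightarrow>
     ordered_space X r \<and> priestley_separation X r \<and>
     openin X = arbitrary union_of (\<lambda>B. B \<in> {U - V | U V. U \<in> ClopUp X r \<and> V \<in> ClopUp X r})"

definition priestley_space :: "'a topology \<Rightarrow> 'a rel \<Rightarrow> bool" where
  "priestley_space X r \<longleftrightarrow> ordered_space X r \<and> compact_space X \<and> priestley_separation X r"

definition nachbin_space :: "'a topology \<Rightarrow> 'a rel \<Rightarrow> bool" where
  "nachbin_space X r \<longleftrightarrow> ordered_space X r \<and> compact_space X \<and> closedin (prod_topology X X) r"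

definition order_embedding ::
    "'a topology \<Rightarrow> 'a rel \<Rightarrow> 'b topology \<Rightarrow> 'b rel \<Rightarrow> ('a \<Rightarrow> 'b) \<Rightarrow> bool" where
  "order_embedding X r Y s e \<longleftrightarrow>
     embedding_map X Y e \<and>
     (\<forall>x\<in>topspace X. \<forall>y\<in>topspace X. (x, y) \<in> r \<longleftrightarrow> (e x, e y) \<in> s)"

definition order_compactification ::
    "'a topology \<Rightarrow> 'a rel \<Rightarrow> 'b topology \<Rightarrow> 'b rel \<Rightarrow> ('a \<Rightarrow> 'b) \<Rightarrow> bool" where
  "order_compactification X r Y s e \<longleftrightarrow>
     nachbin_space Y s \<and> order_embedding X r Y s e \<and>
     Y closure_of (e ` topspace X) = topspace Y"

definition priestley_order_compactification ::
    "'a topology \<Rightarrow> 'a rel \<Rightarrow> 'b topology \<Rightarrow> 'b rel \<Rightarrow> ('a \<Rightarrow> 'b) \<Rightarrow> bool" where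
  "priestley_order_compactification X r Y s e \<longleftrightarrow>
     order_compactification X r Y s e \<and> priestley_space Y s"

definition N_order_compactification ::
    "'a topology \<Rightarrow> 'a rel \<Rightarrow> 'b topology \<Rightarrow> 'b rel \<Rightarrow> ('a \<Rightarrow> 'b) \<Rightarrow> bool" where
  "N_order_compactification X r Y s e \<longleftrightarrow>
     order_compactification X r Y s e \<and>
     s = (prod_topology Y Y) closure_of {(e x, e x') | x x'. (x, x') \<in> r}"

definition trace_ClopUp ::
    "'a topology \<Rightarrow> 'b topology \<Rightarrow> 'b rel \<Rightarrow> ('a \<Rightarrow> 'b) \<Rightarrow> 'a set set" where
  "trace_ClopUp X Y s e = {{x \<in> topspace X. e x \<in> U} | U. U \<in> ClopUp Y s}"

definition trace_clopen :: "'a topology \<Rightarrow> 'b topology \<Rightarrow> ('a \<Rightarrow> 'b) \<Rightarrow> 'a set set" where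
  "trace_clopen X Y e = {{x \<in> topspace X. e x \<in> W} | W. clopenin Y W}"

text \<open>\<open>\<B>\<close> is the family of sets to be separated by members of \<open>\<R>\<close>.\<close>

definition N_basis :: "'a topology \<Rightarrow> 'a rel \<Rightarrow> 'a set set \<Rightarrow> 'a set set \<Rightarrow> bool" where
  "N_basis X r \<R> \<B> \<longleftrightarrow>
     (\<forall>W\<in>\<B>. \<forall>V\<in>\<B>. up_set X r W \<inter> down_set X r V = {} \<longrightarrow>
        (\<exists>K\<in>\<R>. W \<subseteq> K \<and> V \<subseteq> topspace X - K))"

end

theory Submission
  imports Defs
begin

text \<open>Since \<open>e[X]\<close> is dense, clopen sets of \<open>Y\<close> are determined by their traces on \<open>X\<close>, and a
  clopen rectangle \<open>W \<times> V\<close> misses the closure of \<open>(e \<times> e)[\<le>]\<close> exactly when no point of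
  the trace of \<open>W\<close> lies below a point of the trace of \<open>V\<close>. By compactness and Priestley
  separation, it misses the order of \<open>Y\<close> exactly when a clopen upset separates \<open>W\<close> from \<open>V\<close>.
  As clopen rectangles form a basis of \<open>Y \<times> Y\<close>, the order of \<open>Y\<close> is that closure iff every
  clopen rectangle of the first kind is of the second.\<close>

text \<open>Compactness is used twice. For fixed \<open>a\<close>, the complements of the members
  containing \<open>a\<close> cover \<open>B\<close>, so a finite intersection of such members
  misses \<open>B\<close>. The members missing \<open>B\<close> then cover \<open>A\<close>, and a
  finite union of them suffices. The lattice \<open>\<C>\<close> is left abstract because it serves
  both for clopen upsets and for all clopen sets.\<close>

lemma compact_separation:
  assumes A: "compactin Y A" and B: "compactin Y B"
    and clop: "\<And>U. U \<in> \<C> \<Longrightarrow> clopenin Y U"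
    and empty: "{} \<in> \<C>" and full: "topspace Y \<in> \<C>"
    and Un: "\<And>U V. U \<in> \<C> \<Longrightarrow> V \<in> \<C> \<Longrightarrow> U \<union> V \<in> \<C>"
    and Int: "\<And>U V. U \<in> \<C> \<Longrightarrow> V \<in> \<C> \<Longrightarrow> U \<inter> V \<in> \<C>"
    and sep: "\<And>a b. a \<in> A \<Longrightarrow> b \<in> B \<Longrightarrow> \<exists>U\<in>\<C>. a \<in> U \<and> b \<notin> U"
  shows "\<exists>U\<in>\<C>. A \<subseteq> U \<and> U \<inter> B = {}"
proof -
  have UN: "\<Union>\<F> \<in> \<C>" if "finite \<F>" "\<F> \<subseteq> \<C>" for \<F>
    using that by (induction \<F> rule: finite_induct) (auto simp: empty Un)
  \<comment> \<open>Intersecting with \<open>topspace Y\<close> makes the empty family yield the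
    whole space instead of \<open>UNIV\<close>.\<close>
  have IN: "topspace Y \<inter> \<Inter>\<F> \<in> \<C>" if "finite \<F>" "\<F> \<subseteq> \<C>" for \<F>
    using that
  proof (induction \<F> rule: finite_induct)
    case (insert U \<F>)
    then show ?case using Int[of U "topspace Y \<inter> \<Inter>\<F>"] by (simp add: Int_left_commute)
  qed (simp add: full)
  have point: "\<exists>U\<in>\<C>. a \<in> U \<and> U \<inter> B = {}" if a: "a \<in> A" for a
  proof -
    let ?D = "(\<lambda>U. topspace Y - U) ` {U \<in> \<C>. a \<in> U}"
    have "openin Y D" if "D \<in> ?D" for D
      using that clop by (auto simp: clopenin_def)
    moreover have "B \<subseteq> \<Union>?D"
      using sep[OF a] compactin_subset_topspace[OF B] by blast
    ultimately obtain \<D> where \<D>: "finite \<D>" "\<D> \<subseteq> ?D" "B \<subseteq> \<Union>\<D>"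
      using B unfolding compactin_def by meson
    obtain \<F> where \<F>: "finite \<F>" "\<F> \<subseteq> {U \<in> \<C>. a \<in> U}" "\<D> = (\<lambda>U. topspace Y - U) ` \<F>"
      using finite_subset_image[OF \<D>(1,2)] by blast
    have "topspace Y \<inter> \<Inter>\<F> \<in> \<C>"
      using IN \<F> by blast
    moreover have "a \<in> topspace Y \<inter> \<Inter>\<F>"
      using \<F> a compactin_subset_topspace[OF A] by blast
    moreover have "(topspace Y \<inter> \<Inter>\<F>) \<inter> B = {}"
      using \<D>(3) \<F>(3) by blast
    ultimately show ?thesis by blast
  qed
  let ?D = "{U \<in> \<C>. U \<inter> B = {}}"
  have "openin Y D" if "D \<in> ?D" for D
    using that clop by (auto simp: clopenin_def)
  moreover have "A \<subseteq> \<Union>?D"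
    using point by blast
  ultimately obtain \<D> where \<D>: "finite \<D>" "\<D> \<subseteq> ?D" "A \<subseteq> \<Union>\<D>"
    using A unfolding compactin_def by meson
  have "\<Union>\<D> \<in> \<C>" using UN \<D> by blast
  moreover have "\<Union>\<D> \<inter> B = {}" using \<D>(2) by blast
  ultimately show ?thesis using \<D>(3) by blast
qed

lemma is_upset_iff:
  assumes "ordered_space X r"
  shows "is_upset X r S \<longleftrightarrow> S \<subseteq> topspace X \<and> (\<forall>x y. x \<in> S \<longrightarrow> (x, y) \<in> r \<longrightarrow> y \<in> S)"
  using assms
  unfolding is_upset_def up_set_def ordered_space_def partial_order_on_def preorder_on_def refl_on_def
  by blast

lemma ClopUp_iff:
  assumes "ordered_space X r"
  shows "U \<in> ClopUp X r \<longleftrightarrow> clopenin X U \<and> (\<forall>x y. x \<in> U \<longrightarrow> (x, y) \<in> r \<longrightarrow> y \<in> U)"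
  using is_upset_iff[OF assms] closedin_subset by (auto simp: ClopUp_def clopenin_def)

text \<open>Clopen subsets of a compact space are compact, and clopen upsets form a bounded lattice,
  so the Priestley axiom extends from pairs of points to pairs of clopen sets.\<close>

lemma priestley_separation_clopen:
  assumes Y: "priestley_space Y s" and W: "clopenin Y W" and V: "clopenin Y V"
    and disj: "s \<inter> W \<times> V = {}"
  shows "\<exists>U\<in>ClopUp Y s. W \<subseteq> U \<and> U \<inter> V = {}"
proof -
  have ord: "ordered_space Y s" and sep: "priestley_separation Y s" and cpt: "compact_space Y"
    using Y by (auto simp: priestley_space_def)
  have sub: "W \<subseteq> topspace Y" "V \<subseteq> topspace Y"
    using W V by (auto simp: clopenin_def closedin_subset)
  have s: "s \<subseteq> topspace Y \<times> topspace Y"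
    using ord by (auto simp: ordered_space_def partial_order_on_def preorder_on_def)
  show ?thesis
  proof (rule compact_separation)
    show "compactin Y W" "compactin Y V"
      using W V cpt by (auto simp: clopenin_def closedin_compact_space)
    show "\<exists>U\<in>ClopUp Y s. a \<in> U \<and> b \<notin> U" if "a \<in> W" "b \<in> V" for a b
    proof -
      have "(a, b) \<notin> s" "a \<in> topspace Y" "b \<in> topspace Y"
        using that disj sub by auto
      then show ?thesis
        using sep by (simp add: priestley_separation_def)
    qed
    show "topspace Y \<in> ClopUp Y s"
      using s by (auto simp: ClopUp_iff[OF ord] clopenin_def)
  qed (auto simp: ClopUp_iff[OF ord] clopenin_def)
qed

text \<open>By antisymmetry, distinct points fail to be related in at least one direction, so a
  clopen upset or the complement of one separates them. Compactness then separates \<open>y\<close>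
  from the closed set outside \<open>U\<close>.\<close>

lemma priestley_space_clopen_neighbourhood:
  assumes Y: "priestley_space Y s" and U: "openin Y U" and y: "y \<in> U"
  shows "\<exists>W. clopenin Y W \<and> y \<in> W \<and> W \<subseteq> U"
proof -
  have ord: "ordered_space Y s" and sep: "priestley_separation Y s" and cpt: "compact_space Y"
    using Y by (auto simp: priestley_space_def)
  have yY: "y \<in> topspace Y"
    using U y openin_subset by blast
  have "\<exists>W\<in>{W. clopenin Y W}. {y} \<subseteq> W \<and> W \<inter> (topspace Y - U) = {}"
  proof (rule compact_separation)
    show "compactin Y {y}" using yY by simp
    show "compactin Y (topspace Y - U)"
      using U cpt by (auto intro: closedin_compact_space)
    fix a b assume "a \<in> {y}" and b: "b \<in> topspace Y - U"
    then have a: "a = y" by simp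
    have "a \<noteq> b" using a b y by blast
    then consider "(a, b) \<notin> s" | "(b, a) \<notin> s"
      using ord by (auto simp: ordered_space_def partial_order_on_def antisym_def)
    then show "\<exists>W\<in>{W. clopenin Y W}. a \<in> W \<and> b \<notin> W"
    proof cases
      case 1
      then show ?thesis
        using sep a yY b by (auto simp: priestley_separation_def ClopUp_def)
    next
      case 2
      then obtain W where W: "clopenin Y W" "b \<in> W" "a \<notin> W"
        using sep a yY b by (auto simp: priestley_separation_def ClopUp_def)
      then have "clopenin Y (topspace Y - W)"
        by (auto simp: clopenin_def)
      then show ?thesis using W a yY by blast
    qed
  qed (auto simp: clopenin_def)
  then show ?thesis
    by (auto simp: clopenin_def dest: closedin_subset)
qed

text \<open>If the traces are nested, the open set \<open>W - U\<close> misses a dense set, hence is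
  empty.\<close>

lemma trace_subset_iff:
  assumes dense: "Y closure_of (e ` A) = topspace Y" and W: "clopenin Y W" and U: "clopenin Y U"
  shows "{x \<in> A. e x \<in> W} \<subseteq> {x \<in> A. e x \<in> U} \<longleftrightarrow> W \<subseteq> U"
proof
  assume *: "{x \<in> A. e x \<in> W} \<subseteq> {x \<in> A. e x \<in> U}"
  have op: "openin Y (W - U)"
    using W U by (auto simp: clopenin_def)
  have "(W - U) \<inter> e ` A = {}"
    using * by blast
  then have "(W - U) \<inter> Y closure_of (e ` A) = {}"
    using openin_Int_closure_of_eq_empty[OF op] by blast
  then show "W \<subseteq> U"
    using dense openin_subset[OF op] by blast
qed blast

theorem theorem3p13:
  fixes X :: "'a topology" and leX :: "'a rel"
    and Y :: "'b topology" and leY :: "'b rel"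
    and e :: "'a \<Rightarrow> 'b"
  assumes "order_zero_dimensional X leX"
    and "priestley_order_compactification X leX Y leY e"
  shows "N_order_compactification X leX Y leY e \<longleftrightarrow>
         N_basis X leX (trace_ClopUp X Y leY e) (trace_clopen X Y e)"
proof -
  define G where "G = {(e x, e x') | x x'. (x, x') \<in> leX}"
  let ?cl = "prod_topology Y Y closure_of G"
  let ?tr = "\<lambda>W. {x \<in> topspace X. e x \<in> W}"
  have comp: "order_compactification X leX Y leY e" and Y: "priestley_space Y leY"
    using assms(2) by (auto simp: priestley_order_compactification_def)
  have ordY: "ordered_space Y leY" and closed: "closedin (prod_topology Y Y) leY"
    and emb: "order_embedding X leX Y leY e"
    and dense: "Y closure_of (e ` topspace X) = topspace Y"
    using comp by (auto simp: order_compactification_def nachbin_space_def)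
  have ordX: "ordered_space X leX"
    using assms(1) by (auto simp: order_zero_dimensional_def)
  have leX: "leX \<subseteq> topspace X \<times> topspace X" and reflX: "\<And>x. x \<in> topspace X \<Longrightarrow> (x, x) \<in> leX"
    and transX: "trans leX"
    using ordX by (auto simp: ordered_space_def partial_order_on_def preorder_on_def refl_on_def)
  have G_le: "G \<subseteq> leY"
    using emb leX unfolding order_embedding_def G_def by blast
  have cl_le: "?cl \<subseteq> leY"
    by (rule closure_of_minimal[OF G_le closed])
  \<comment> \<open>The order of \<open>Y\<close> is closed and contains \<open>G\<close>, so one
    inclusion always holds and only the other is at stake.\<close>
  have N_iff: "N_order_compactification X leX Y leY e \<longleftrightarrow> leY \<subseteq> ?cl"
    using comp cl_le by (auto simp: N_order_compactification_def G_def)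
  \<comment> \<open>A common point \<open>x\<close> of the two sets lies between some
    \<open>w\<close> and \<open>v\<close>, which transitivity relates directly. Conversely, for
    related \<open>x\<close> and \<open>x'\<close>, reflexivity puts \<open>x'\<close> itself in
    both sets.\<close>
  have rect: "up_set X leX (?tr W) \<inter> down_set X leX (?tr V) = {} \<longleftrightarrow> G \<inter> W \<times> V = {}" for W V
  proof
    assume *: "up_set X leX (?tr W) \<inter> down_set X leX (?tr V) = {}"
    have False if "(x, x') \<in> leX" "e x \<in> W" "e x' \<in> V" for x x'
    proof -
      have "x' \<in> up_set X leX (?tr W) \<inter> down_set X leX (?tr V)"
        using that leX reflX by (auto simp: up_set_def down_set_def)
      with * show False by blast
    qed
    then show "G \<inter> W \<times> V = {}" unfolding G_def by blast
  next
    assume *: "G \<inter> W \<times> V = {}"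
    have False if "x \<in> up_set X leX (?tr W)" "x \<in> down_set X leX (?tr V)" for x
    proof -
      obtain w v where "e w \<in> W" "e v \<in> V" "(w, x) \<in> leX" "(x, v) \<in> leX"
        using \<open>x \<in> up_set X leX (?tr W)\<close> \<open>x \<in> down_set X leX (?tr V)\<close>
        by (auto simp: up_set_def down_set_def)
      then show False using * transD[OF transX, of w x v] unfolding G_def by blast
    qed
    then show "up_set X leX (?tr W) \<inter> down_set X leX (?tr V) = {}" by blast
  qed
  \<comment> \<open>Every member of the two trace families comes from a set in \<open>Y\<close>, so
    the quantifiers can range over clopen sets and clopen upsets of \<open>Y\<close>.\<close>
  have basis_iff: "N_basis X leX (trace_ClopUp X Y leY e) (trace_clopen X Y e) \<longleftrightarrow>
      (\<forall>W V. clopenin Y W \<longrightarrow> clopenin Y V \<longrightarrow> G \<inter> W \<times> V = {} \<longrightarrow>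
        (\<exists>U\<in>ClopUp Y leY. ?tr W \<subseteq> ?tr U \<and> ?tr V \<subseteq> topspace X - ?tr U))"
  proof -
    have "trace_clopen X Y e = ?tr ` {W. clopenin Y W}" "trace_ClopUp X Y leY e = ?tr ` ClopUp Y leY"
      by (auto simp: trace_clopen_def trace_ClopUp_def)
    then show ?thesis
      by (simp only: N_basis_def ball_simps bex_simps rect mem_Collect_eq imp_conjL all_simps)
  qed
  show ?thesis
    unfolding N_iff basis_iff
  proof (intro iffI allI impI)
    fix W V
    assume le: "leY \<subseteq> ?cl" and W: "clopenin Y W" and V: "clopenin Y V" and G: "G \<inter> W \<times> V = {}"
    have "openin (prod_topology Y Y) (W \<times> V)"
      using W V by (auto simp: clopenin_def openin_prod_Times_iff)
    \<comment> \<open>An open rectangle disjoint from \<open>G\<close> is disjoint from its closure,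
      which contains the order.\<close>
    then have "leY \<inter> W \<times> V = {}"
      using openin_Int_closure_of_eq_empty[of "prod_topology Y Y" "W \<times> V" G] G le by blast
    then show "\<exists>U\<in>ClopUp Y leY. ?tr W \<subseteq> ?tr U \<and> ?tr V \<subseteq> topspace X - ?tr U"
      using priestley_separation_clopen[OF Y W V] by blast
  next
    assume sep: "\<forall>W V. clopenin Y W \<longrightarrow> clopenin Y V \<longrightarrow> G \<inter> W \<times> V = {} \<longrightarrow>
        (\<exists>U\<in>ClopUp Y leY. ?tr W \<subseteq> ?tr U \<and> ?tr V \<subseteq> topspace X - ?tr U)"
    show "leY \<subseteq> ?cl"
    proof (rule subrelI, rule ccontr)
      fix y z
      assume yz: "(y, z) \<in> leY" and notin: "(y, z) \<notin> ?cl"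
      have "(y, z) \<in> topspace (prod_topology Y Y)"
        using closedin_subset[OF closed] yz by blast
      then obtain T where T: "openin (prod_topology Y Y) T" "(y, z) \<in> T" "G \<inter> T = {}"
        using notin unfolding in_closure_of by blast
      obtain A B where AB: "openin Y A" "openin Y B" "y \<in> A" "z \<in> B" "A \<times> B \<subseteq> T"
        using T(1)[unfolded openin_prod_topology_alt, rule_format, OF T(2)] by auto
      \<comment> \<open>The neighbourhood is shrunk to a clopen rectangle, the only kind to which
        \<open>sep\<close> applies.\<close>
      obtain W V where W: "clopenin Y W" "y \<in> W" "W \<subseteq> A" and V: "clopenin Y V" "z \<in> V" "V \<subseteq> B"
        using priestley_space_clopen_neighbourhood[OF Y AB(1,3)]
          priestley_space_clopen_neighbourhood[OF Y AB(2,4)] by auto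
      have "W \<times> V \<subseteq> T"
        using W(3) V(3) AB(5) by blast
      then have "G \<inter> W \<times> V = {}"
        using T(3) by blast
      then obtain U where U: "U \<in> ClopUp Y leY" "?tr W \<subseteq> ?tr U" "?tr V \<subseteq> topspace X - ?tr U"
        using sep W(1) V(1) by blast
      have clU: "clopenin Y U" and up: "\<And>x y. x \<in> U \<Longrightarrow> (x, y) \<in> leY \<Longrightarrow> y \<in> U"
        using U(1) by (auto simp: ClopUp_iff[OF ordY])
      \<comment> \<open>Density lifts the inclusion of traces to \<open>Y\<close>; the upset
        \<open>U\<close> then contains \<open>y\<close> and hence \<open>z\<close>.\<close>
      have "W \<subseteq> U"
        using trace_subset_iff[OF dense W(1) clU] U(2) by simp
      then have "z \<in> U" using up yz W(2) by blast
      \<comment> \<open>Disjointness of the traces of \<open>U\<close> and \<open>V\<close> is read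
        as inclusion in the trace of the empty set, so density gives disjointness in
        \<open>Y\<close>, against \<open>z\<close> lying in both.\<close>
      have "clopenin Y (U \<inter> V)" "clopenin Y {}"
        using clU V(1) by (auto simp: clopenin_def)
      moreover have "?tr (U \<inter> V) \<subseteq> ?tr {}"
        using U(3) by blast
      ultimately have "U \<inter> V \<subseteq> {}"
        by (rule trace_subset_iff[OF dense, THEN iffD1])
      then show False using \<open>z \<in> U\<close> V(2) by blast
    qed
  qed
qed

end
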